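(* Let $(\Omega,M)$ be a primitive transitive finite transformation monoid with $|\Omega|\ge 3$ and let $e\in E(I(M))$. Then $(\Omega e,G_e)$ is a primitive permutation group. If $G_e$ is non-trivial, then $\Omega\cong\mathrm{ind}_e(\Omega e)/{='}$ as $M$-sets, where $='$ is the congruence on $\mathrm{ind}_e(\Omega e)$ given by $x\mathrel{='}y$ if and only if $xme=yme$ for all $m\in M$.
   Context: A transformation monoid $(\Omega,M)$ is a non-empty set $\Omega$ with a submonoid $M$ of the monoid of all self-maps of $\Omega$, acting on the right; it is finite if $\Omega$ is finite. It is transitive if $\alpha M=\Omega$ for all $\alpha\in\Omega$. A congruence on a right $M$-set is an equivalence relation $\equiv$ such that $\alpha\equiv\beta$ implies $\alpha m\equiv\beta m$ for all $m\in M$; it is non-trivial if it is not equality, and proper if it is not the universal relation. A transformation monoid (in particular a permutation group) is primitive if it admits no non-trivial proper congruence. $I(M)$ is the unique minimal two-sided ideal of the finite monoid $M$ and $E(I(M))$ is its set of idempotents. $G_e$ is the group of units of the monoid $eMe$ (with identity $e$), acting on $\Omega e$ by restriction; for $e\in E(I(M))$ one has $eMe=G_e$. For a right $eMe$-set $\Lambda$, $\mathrm{ind}_e(\Lambda)=\Lambda\otimes_{eMe}eM$ is the quotient of $\Lambda\times eM$ by the equivalence relation generated by $(\lambda n,m)\approx(\lambda,nm)$ for $\lambda\in\Lambda$, $n\in eMe$, $m\in eM$, with right $M$-action $(\lambda\otimes m)m'=\lambda\otimes mm'$. *)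

theory Defs
  imports "HOL-Algebra.Bij"
begin

section \<open>Right actions of a monoid\<close>

definition right_action :: "('m, 'z) monoid_scheme \<Rightarrow> 'x set \<Rightarrow> ('x \<Rightarrow> 'm \<Rightarrow> 'x) \<Rightarrow> bool"
  where "right_action S X act \<longleftrightarrow>
    monoid S \<and>
    (\<forall>x\<in>X. \<forall>m\<in>carrier S. act x m \<in> X) \<and>
    (\<forall>x\<in>X. act x \<one>\<^bsub>S\<^esub> = x) \<and>
    (\<forall>x\<in>X. \<forall>m\<in>carrier S. \<forall>n\<in>carrier S. act (act x m) n = act x (m \<otimes>\<^bsub>S\<^esub> n))"

definition action_congruence ::
    "('m, 'z) monoid_scheme \<Rightarrow> 'x set \<Rightarrow> ('x \<Rightarrow> 'm \<Rightarrow> 'x) \<Rightarrow> ('x \<times> 'x) set \<Rightarrow> bool"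
  where "action_congruence S X act r \<longleftrightarrow>
    equiv X r \<and> (\<forall>(x, y)\<in>r. \<forall>m\<in>carrier S. (act x m, act y m) \<in> r)"

definition primitive_action ::
    "('m, 'z) monoid_scheme \<Rightarrow> 'x set \<Rightarrow> ('x \<Rightarrow> 'm \<Rightarrow> 'x) \<Rightarrow> bool"
  where "primitive_action S X act \<longleftrightarrow>
    right_action S X act \<and>
    \<not> (\<exists>r. action_congruence S X act r \<and> r \<noteq> Id_on X \<and> r \<noteq> X \<times> X)"

text \<open>The action induced on the quotient \<open>X // r\<close>.  If \<open>r\<close> is a congruence on \<open>X\<close>, the
  members of the union are all equal.\<close>

definition quotient_act :: "('x \<times> 'x) set \<Rightarrow> ('x \<Rightarrow> 'm \<Rightarrow> 'x) \<Rightarrow> 'x set \<Rightarrow> 'm \<Rightarrow> 'x set"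
  where "quotient_act r act A m = (\<Union>x\<in>A. r `` {act x m})"

definition isomorphic_actions ::
    "('m, 'z) monoid_scheme \<Rightarrow> 'x set \<Rightarrow> ('x \<Rightarrow> 'm \<Rightarrow> 'x) \<Rightarrow> 'y set \<Rightarrow> ('y \<Rightarrow> 'm \<Rightarrow> 'y) \<Rightarrow> bool"
  where "isomorphic_actions S X actX Y actY \<longleftrightarrow>
    right_action S X actX \<and> right_action S Y actY \<and>
    (\<exists>\<phi>. bij_betw \<phi> X Y \<and> (\<forall>x\<in>X. \<forall>m\<in>carrier S. \<phi> (actX x m) = actY (\<phi> x) m))"


section \<open>Transformation monoids\<close>

text \<open>Self-maps of \<open>\<Omega>\<close> are represented as extensional functions, as in \<^const>\<open>BijGroup\<close>.
  They act on the right, so \<open>f \<otimes> g\<close> is ``first \<open>f\<close>, then \<open>g\<close>''.\<close>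

definition full_transformation_monoid :: "'a set \<Rightarrow> ('a \<Rightarrow> 'a) monoid"
  where "full_transformation_monoid \<Omega> =
    \<lparr>carrier = \<Omega> \<rightarrow>\<^sub>E \<Omega>, mult = \<lambda>f g. compose \<Omega> g f, one = \<lambda>x\<in>\<Omega>. x\<rparr>"

definition tmonoid :: "'a set \<Rightarrow> ('a \<Rightarrow> 'a) set \<Rightarrow> ('a \<Rightarrow> 'a) monoid"
  where "tmonoid \<Omega> M = (full_transformation_monoid \<Omega>)\<lparr>carrier := M\<rparr>"

definition transformation_monoid :: "'a set \<Rightarrow> ('a \<Rightarrow> 'a) set \<Rightarrow> bool"
  where "transformation_monoid \<Omega> M \<longleftrightarrow>
    \<Omega> \<noteq> {} \<and> submonoid M (full_transformation_monoid \<Omega>)"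

definition app :: "'a \<Rightarrow> ('a \<Rightarrow> 'a) \<Rightarrow> 'a"
  where "app \<alpha> m = m \<alpha>"

definition transitive_tm :: "'a set \<Rightarrow> ('a \<Rightarrow> 'a) set \<Rightarrow> bool"
  where "transitive_tm \<Omega> M \<longleftrightarrow> (\<forall>\<alpha>\<in>\<Omega>. app \<alpha> ` M = \<Omega>)"

definition primitive_tm :: "'a set \<Rightarrow> ('a \<Rightarrow> 'a) set \<Rightarrow> bool"
  where "primitive_tm \<Omega> M \<longleftrightarrow> primitive_action (tmonoid \<Omega> M) \<Omega> app"

text \<open>\<^const>\<open>BijGroup\<close> composes from right to left; as a set of maps, a subgroup of it is
  the same thing as a subgroup for the opposite order of composition.\<close>

definition permutation_group :: "'a set \<Rightarrow> ('a \<Rightarrow> 'a) set \<Rightarrow> bool"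
  where "permutation_group \<Omega> G \<longleftrightarrow> \<Omega> \<noteq> {} \<and> subgroup G (BijGroup \<Omega>)"


section \<open>The minimal ideal, and the groups of units of local monoids\<close>

definition two_sided_ideal :: "('m, 'z) monoid_scheme \<Rightarrow> 'm set \<Rightarrow> bool"
  where "two_sided_ideal S I \<longleftrightarrow>
    I \<noteq> {} \<and> I \<subseteq> carrier S \<and>
    (\<forall>x\<in>I. \<forall>m\<in>carrier S. x \<otimes>\<^bsub>S\<^esub> m \<in> I \<and> m \<otimes>\<^bsub>S\<^esub> x \<in> I)"

definition minimal_ideal :: "('m, 'z) monoid_scheme \<Rightarrow> 'm set \<Rightarrow> bool"
  where "minimal_ideal S I \<longleftrightarrow>
    two_sided_ideal S I \<and> (\<forall>J. two_sided_ideal S J \<and> J \<subseteq> I \<longrightarrow> J = I)"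

definition min_ideal :: "('m, 'z) monoid_scheme \<Rightarrow> 'm set"
  where "min_ideal S = (THE I. minimal_ideal S I)"

lemma minimal_ideal_ex1:
  assumes "monoid S" "finite (carrier S)"
  shows "\<exists>!I. minimal_ideal S I"
proof (rule ex_ex1I)
  let ?A = "{I. two_sided_ideal S I}"
  have "two_sided_ideal S (carrier S)"
    using monoid.one_closed[OF assms(1)] monoid.m_closed[OF assms(1)]
    by (simp add: two_sided_ideal_def) blast
  then have ne: "?A \<noteq> {}"
    by blast
  have "?A \<subseteq> Pow (carrier S)"
    by (simp add: two_sided_ideal_def subset_iff)
  then have "finite ?A"
    using assms(2) by (meson finite_Pow_iff finite_subset)
  from finite_has_minimal[OF this ne]
  obtain I where "two_sided_ideal S I" "\<forall>J. two_sided_ideal S J \<longrightarrow> J \<subseteq> I \<longrightarrow> I = J"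
    by auto
  then show "\<exists>I. minimal_ideal S I"
    by (metis minimal_ideal_def)
next
  fix I J assume IJ: "minimal_ideal S I" "minimal_ideal S J"
  then have I: "two_sided_ideal S I" and J: "two_sided_ideal S J"
    by (simp_all add: minimal_ideal_def)
  have I': "I \<noteq> {}" "I \<subseteq> carrier S"
      "\<And>x m. x \<in> I \<Longrightarrow> m \<in> carrier S \<Longrightarrow> x \<otimes>\<^bsub>S\<^esub> m \<in> I \<and> m \<otimes>\<^bsub>S\<^esub> x \<in> I"
    using I by (simp_all add: two_sided_ideal_def)
  have J': "J \<noteq> {}" "J \<subseteq> carrier S"
      "\<And>x m. x \<in> J \<Longrightarrow> m \<in> carrier S \<Longrightarrow> x \<otimes>\<^bsub>S\<^esub> m \<in> J \<and> m \<otimes>\<^bsub>S\<^esub> x \<in> J"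
    using J by (simp_all add: two_sided_ideal_def)
  obtain x y where x: "x \<in> I" "x \<in> carrier S" and y: "y \<in> J" "y \<in> carrier S"
    using I'(1,2) J'(1,2) by blast
  have "x \<otimes>\<^bsub>S\<^esub> y \<in> I \<inter> J"
    using I'(3)[OF x(1) y(2)] J'(3)[OF y(1) x(2)] by simp
  then have ne: "I \<inter> J \<noteq> {}"
    by (metis empty_iff)
  have "two_sided_ideal S (I \<inter> J)"
    unfolding two_sided_ideal_def
  proof (intro conjI ballI)
    show "I \<inter> J \<noteq> {}" by (rule ne)
    show "I \<inter> J \<subseteq> carrier S" by (rule le_infI1[OF I'(2)])
  next
    fix z m assume "z \<in> I \<inter> J" "m \<in> carrier S"
    then show "z \<otimes>\<^bsub>S\<^esub> m \<in> I \<inter> J" "m \<otimes>\<^bsub>S\<^esub> z \<in> I \<inter> J"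
      using I'(3)[of z m] J'(3)[of z m] by simp_all
  qed
  then have "I \<inter> J = I" "I \<inter> J = J"
    using IJ by (simp_all add: minimal_ideal_def)
  then show "I = J"
    by simp
qed

definition idempotents :: "('m, 'z) monoid_scheme \<Rightarrow> 'm set \<Rightarrow> 'm set"
  where "idempotents S A = {e \<in> A. e \<otimes>\<^bsub>S\<^esub> e = e}"

text \<open>The monoid \<open>eSe\<close>, with identity \<open>e\<close>.\<close>

definition local_monoid :: "('m, 'z) monoid_scheme \<Rightarrow> 'm \<Rightarrow> ('m, 'z) monoid_scheme"
  where "local_monoid S e =
    S\<lparr>carrier := (\<lambda>m. e \<otimes>\<^bsub>S\<^esub> m \<otimes>\<^bsub>S\<^esub> e) ` carrier S, one := e\<rparr>"

definition maximal_subgroup :: "('m, 'z) monoid_scheme \<Rightarrow> 'm \<Rightarrow> 'm monoid"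
  where "maximal_subgroup S e = units_of (local_monoid S e)"


section \<open>Induced right actions\<close>

definition generated_equiv :: "'x set \<Rightarrow> ('x \<times> 'x) set \<Rightarrow> ('x \<times> 'x) set"
  where "generated_equiv X r = (X \<times> X) \<inter> \<Inter> {q. equiv X q \<and> r \<subseteq> q}"

lemma equiv_generated_equiv: "equiv X (generated_equiv X r)"
proof (rule equivI)
  show "refl_on X (generated_equiv X r)"
    by (rule refl_onI) (simp add: generated_equiv_def equiv_def refl_on_def)
  show "sym (generated_equiv X r)"
    by (rule symI) (simp add: generated_equiv_def equiv_def sym_def)
  show "trans (generated_equiv X r)"
  proof (rule transI)
    fix x y z
    assume xy: "(x, y) \<in> generated_equiv X r" and yz: "(y, z) \<in> generated_equiv X r"
    have "(x, z) \<in> q" if "equiv X q" "r \<subseteq> q" for q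
    proof -
      have "(x, y) \<in> q" "(y, z) \<in> q" "trans q"
        using xy yz that by (simp_all add: generated_equiv_def equiv_def)
      then show ?thesis by (blast dest: transD)
    qed
    then show "(x, z) \<in> generated_equiv X r"
      using xy yz by (simp add: generated_equiv_def)
  qed
qed (simp add: generated_equiv_def)

text \<open>\<open>\<Lambda> \<otimes>\<^bsub>eSe\<^esub> eS\<close> for a right \<open>eSe\<close>-set \<open>\<Lambda>\<close> with action \<open>act\<close>, together with its
  right \<open>S\<close>-action.\<close>

definition ind_base :: "('m, 'z) monoid_scheme \<Rightarrow> 'm \<Rightarrow> 'x set \<Rightarrow> ('x \<times> 'm) set"
  where "ind_base S e \<Lambda> = \<Lambda> \<times> ((\<lambda>m. e \<otimes>\<^bsub>S\<^esub> m) ` carrier S)"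

definition ind_rel ::
    "('m, 'z) monoid_scheme \<Rightarrow> 'm \<Rightarrow> 'x set \<Rightarrow> ('x \<Rightarrow> 'm \<Rightarrow> 'x) \<Rightarrow> (('x \<times> 'm) \<times> ('x \<times> 'm)) set"
  where "ind_rel S e \<Lambda> act = generated_equiv (ind_base S e \<Lambda>)
    {((act x n, m), (x, n \<otimes>\<^bsub>S\<^esub> m)) | x n m.
       x \<in> \<Lambda> \<and> n \<in> carrier (local_monoid S e) \<and> m \<in> (\<lambda>m. e \<otimes>\<^bsub>S\<^esub> m) ` carrier S}"

definition ind ::
    "('m, 'z) monoid_scheme \<Rightarrow> 'm \<Rightarrow> 'x set \<Rightarrow> ('x \<Rightarrow> 'm \<Rightarrow> 'x) \<Rightarrow> ('x \<times> 'm) set set"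
  where "ind S e \<Lambda> act = ind_base S e \<Lambda> // ind_rel S e \<Lambda> act"

definition ind_act ::
    "('m, 'z) monoid_scheme \<Rightarrow> 'm \<Rightarrow> 'x set \<Rightarrow> ('x \<Rightarrow> 'm \<Rightarrow> 'x) \<Rightarrow>
     ('x \<times> 'm) set \<Rightarrow> 'm \<Rightarrow> ('x \<times> 'm) set"
  where "ind_act S e \<Lambda> act =
    quotient_act (ind_rel S e \<Lambda> act) (\<lambda>(x, m) m'. (x, m \<otimes>\<^bsub>S\<^esub> m'))"

text \<open>The relation \<open>='\<close>, for a right \<open>S\<close>-set \<open>X\<close>.\<close>

definition eq_prime ::
    "('m, 'z) monoid_scheme \<Rightarrow> 'm \<Rightarrow> 'x set \<Rightarrow> ('x \<Rightarrow> 'm \<Rightarrow> 'x) \<Rightarrow> ('x \<times> 'x) set"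
  where "eq_prime S e X act =
    {(x, y). x \<in> X \<and> y \<in> X \<and> (\<forall>m\<in>carrier S. act (act x m) e = act (act y m) e)}"

end

theory Submission
  imports Defs
begin

text \<open>
  Everything rests on one way of producing congruences.  Let \<open>S\<close> act on \<open>X\<close> and let \<open>e\<close> be an
  idempotent of \<open>S\<close>.  An equivalence \<open>q\<close> on \<open>Xe\<close> that is stable under \<open>eSe\<close> lifts to the congruence
  of \<open>X\<close> relating \<open>x\<close> and \<open>y\<close> if \<open>xme\<close> and \<open>yme\<close> are \<open>q\<close>-related for every \<open>m\<close>, and the restriction
  of this lift to \<open>Xe\<close> is \<open>q\<close> again.  If \<open>X\<close> is primitive, the lift is equality or universal, and
  then so is \<open>q\<close>: hence \<open>Xe\<close> is a primitive \<open>eSe\<close>-set (\<open>primitive_local_congruence\<close>).  For \<open>e\<close> in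
  the minimal ideal of a finite monoid the local monoid \<open>eSe\<close> is a group (\<open>Units_local_monoid\<close>),
  and in a transformation monoid it acts faithfully on \<open>\<Omega>e\<close>; this is the first assertion.

  The lift of equality is the relation \<open>='\<close>, which is defined for every \<open>S\<close>-set.  On a primitive
  \<open>X\<close> it is equality unless \<open>Xe\<close> is a single point, and if \<open>\<Omega>e\<close> is a single point then the faithful
  group \<open>G\<^sub>e\<close> is trivial.  Now consider the evaluation \<open>x \<otimes> m \<mapsto> xm\<close> from the induced action to
  \<open>X\<close>.  It is equivariant, and surjective by transitivity.  Since
  \<open>(x \<otimes> n)me = x \<otimes> nme = xnme \<otimes> e\<close>, the element \<open>zme\<close> depends only on the value of \<open>z\<close>, and
  conversely the value of \<open>zme\<close> is that of \<open>z\<close> multiplied by \<open>me\<close>.  So two elements of the induced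
  action are \<open>='\<close>-related exactly if their values are, that is, if their values are equal
  (\<open>eq_prime_ind_iff\<close>): \<open>='\<close> is the kernel of the evaluation, and the quotient is isomorphic
  to \<open>X\<close>.
\<close>

section \<open>Congruences and quotients of right actions\<close>

lemma right_actionD:
  assumes "right_action S X act"
  shows "monoid S"
    and "\<And>x m. x \<in> X \<Longrightarrow> m \<in> carrier S \<Longrightarrow> act x m \<in> X"
    and "\<And>x. x \<in> X \<Longrightarrow> act x \<one>\<^bsub>S\<^esub> = x"
    and "\<And>x m n. x \<in> X \<Longrightarrow> m \<in> carrier S \<Longrightarrow> n \<in> carrier S \<Longrightarrow>
           act (act x m) n = act x (m \<otimes>\<^bsub>S\<^esub> n)"
  using assms by (auto simp: right_action_def)

lemma quotient_act_class:
  assumes "right_action S X act" "action_congruence S X act r" "x \<in> X" "m \<in> carrier S"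
  shows "quotient_act r act (r `` {x}) m = r `` {act x m}"
proof -
  have r: "equiv X r" using assms(2) by (simp add: action_congruence_def)
  have "r `` {act y m} = r `` {act x m}" if "y \<in> r `` {x}" for y
  proof -
    have "(act x m, act y m) \<in> r"
      using assms(2,4) that by (auto simp: action_congruence_def)
    then show ?thesis using equiv_class_eq[OF r] by simp
  qed
  moreover have "x \<in> r `` {x}" using equiv_class_self[OF r assms(3)] .
  ultimately show ?thesis unfolding quotient_act_def by blast
qed

lemma right_action_quotient:
  assumes ra: "right_action S X act" and c: "action_congruence S X act r"
  shows "right_action S (X // r) (quotient_act r act)"
proof -
  note D = right_actionD[OF ra]
  interpret monoid S by (rule D(1))
  note q = quotient_act_class[OF ra c]
  show ?thesis
    unfolding right_action_def
    by (auto elim!: quotientE simp: q D monoid_axioms intro!: quotientI)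
qed

lemma equiv_vimage:
  assumes "equiv Y q" "\<And>x. x \<in> X \<Longrightarrow> f x \<in> Y"
  shows "equiv X {(x, y). x \<in> X \<and> y \<in> X \<and> (f x, f y) \<in> q}"
proof (rule equivI)
  show "refl_on X {(x, y). x \<in> X \<and> y \<in> X \<and> (f x, f y) \<in> q}"
    using assms by (auto simp: refl_on_def equiv_def)
  show "sym {(x, y). x \<in> X \<and> y \<in> X \<and> (f x, f y) \<in> q}"
    using assms by (auto simp: sym_def equiv_def)
  show "trans {(x, y). x \<in> X \<and> y \<in> X \<and> (f x, f y) \<in> q}"
    using assms by (auto simp: equiv_def intro!: transI dest: transD)
qed auto

lemma generated_equiv_least:
  assumes "equiv X q" "R \<subseteq> q"
  shows "generated_equiv X R \<subseteq> q"
  using assms by (auto simp: generated_equiv_def)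

lemma generated_equiv_respects:
  assumes "(x, y) \<in> generated_equiv X R" "R \<subseteq> X \<times> X"
    and "\<And>a b. (a, b) \<in> R \<Longrightarrow> f a = f b"
  shows "f x = f y"
proof -
  let ?q = "{(x, y). x \<in> X \<and> y \<in> X \<and> (f x, f y) \<in> Id}"
  have "equiv X ?q"
    by (rule equiv_vimage[of UNIV]) (auto simp: equiv_def refl_on_def sym_def trans_def)
  moreover have "R \<subseteq> ?q" using assms(2,3) by auto
  ultimately have "generated_equiv X R \<subseteq> ?q" by (rule generated_equiv_least)
  then show ?thesis using assms(1) by auto
qed

lemma subset_generated_equiv: "R \<subseteq> X \<times> X \<Longrightarrow> R \<subseteq> generated_equiv X R"
  by (auto simp: generated_equiv_def)

text \<open>The preimage of the generated equivalence under the action of a fixed \<open>m\<close> is an equivalence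
  that contains the generators, hence contains everything they generate.\<close>

lemma action_congruence_generated_equiv:
  assumes ra: "right_action S X act" and RX: "R \<subseteq> X \<times> X"
    and R: "\<And>x y m. (x, y) \<in> R \<Longrightarrow> m \<in> carrier S \<Longrightarrow> (act x m, act y m) \<in> R"
  shows "action_congruence S X act (generated_equiv X R)"
proof -
  let ?g = "generated_equiv X R"
  have "(act x m, act y m) \<in> ?g" if xy: "(x, y) \<in> ?g" and m: "m \<in> carrier S" for x y m
  proof -
    let ?q = "{(x, y). x \<in> X \<and> y \<in> X \<and> (act x m, act y m) \<in> ?g}"
    have "equiv X ?q"
      by (rule equiv_vimage[OF equiv_generated_equiv]) (rule right_actionD(2)[OF ra _ m])
    moreover have "R \<subseteq> ?q" using RX R[OF _ m] subset_generated_equiv[OF RX] by auto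
    ultimately have "?g \<subseteq> ?q" by (rule generated_equiv_least)
    then show ?thesis using xy by auto
  qed
  then show ?thesis
    by (auto simp: action_congruence_def equiv_generated_equiv)
qed

text \<open>The first isomorphism theorem: a point corresponds to its fibre.\<close>

lemma isomorphic_actions_quotient_kernel:
  assumes raX: "right_action S X actX" and raY: "right_action S Y actY"
    and c: "action_congruence S X actX r"
    and surj: "f ` X = Y"
    and equivariant: "\<And>x m. x \<in> X \<Longrightarrow> m \<in> carrier S \<Longrightarrow> f (actX x m) = actY (f x) m"
    and kernel: "\<And>x y. x \<in> X \<Longrightarrow> y \<in> X \<Longrightarrow> (x, y) \<in> r \<longleftrightarrow> f x = f y"
  shows "isomorphic_actions S Y actY (X // r) (quotient_act r actX)"
proof -
  have r: "equiv X r" using c by (simp add: action_congruence_def)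
  define \<phi> where "\<phi> y = {x \<in> X. f x = y}" for y
  have \<phi>: "\<phi> (f x) = r `` {x}" if "x \<in> X" for x
    using kernel[OF that] equiv_type[OF r] by (auto simp: \<phi>_def)
  have "inj_on \<phi> Y"
    using surj by (auto simp: inj_on_def \<phi>_def)
  moreover have "\<phi> ` Y = X // r"
    using \<phi> unfolding surj[symmetric] image_image quotient_def by auto
  ultimately have "bij_betw \<phi> Y (X // r)" by (simp add: bij_betw_def)
  moreover have "\<phi> (actY y m) = quotient_act r actX (\<phi> y) m"
    if y: "y \<in> Y" and m: "m \<in> carrier S" for y m
  proof -
    obtain x where x: "x \<in> X" "y = f x" using y surj by auto
    show ?thesis
      using quotient_act_class[OF raX c x(1) m] \<phi> x equivariant[OF x(1) m]
        right_actionD(2)[OF raX x(1) m] by metis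
  qed
  ultimately show ?thesis
    unfolding isomorphic_actions_def using raY right_action_quotient[OF raX c] by blast
qed


section \<open>Lifting congruences from the local monoid\<close>

definition lifted_congruence ::
    "('m, 'z) monoid_scheme \<Rightarrow> 'm \<Rightarrow> 'x set \<Rightarrow> ('x \<Rightarrow> 'm \<Rightarrow> 'x) \<Rightarrow> ('x \<times> 'x) set \<Rightarrow> ('x \<times> 'x) set"
  where "lifted_congruence S e X act q =
    {(x, y). x \<in> X \<and> y \<in> X \<and> (\<forall>m\<in>carrier S. (act (act x m) e, act (act y m) e) \<in> q)}"

lemma eq_prime_eq_lifted_congruence: "eq_prime S e X act = lifted_congruence S e X act Id"
  by (simp add: eq_prime_def lifted_congruence_def)

lemma action_congruence_lifted_congruence:
  assumes ra: "right_action S X act" and q: "equiv Y q"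
    and Y: "\<And>x. x \<in> X \<Longrightarrow> act x e \<in> Y"
  shows "action_congruence S X act (lifted_congruence S e X act q)"
proof -
  note D = right_actionD[OF ra]
  interpret monoid S by (rule D(1))
  have q': "refl_on Y q" "sym q" "trans q" using q by (auto simp: equiv_def)
  have "equiv X (lifted_congruence S e X act q)"
  proof (rule equivI)
    show "refl_on X (lifted_congruence S e X act q)"
      using q'(1) Y D(2) by (auto simp: lifted_congruence_def refl_on_def)
    show "sym (lifted_congruence S e X act q)"
      using q'(2) by (auto simp: lifted_congruence_def sym_def)
    show "trans (lifted_congruence S e X act q)"
      using q'(3) by (auto simp: lifted_congruence_def intro!: transI dest: transD)
  qed (auto simp: lifted_congruence_def)
  then show ?thesis
    by (auto simp: action_congruence_def lifted_congruence_def D(2,4))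
qed

locale idempotent_action =
  fixes S :: "('m, 'z) monoid_scheme" (structure) and X :: "'x set" and act and e
  assumes right_action: "right_action S X act"
    and e_closed: "e \<in> carrier S"
    and idem: "e \<otimes> e = e"
begin

sublocale monoid S
  by (rule right_actionD(1)[OF right_action])

lemmas act_closed = right_actionD(2)[OF right_action]
  and act_act = right_actionD(4)[OF right_action]

abbreviation Xe where "Xe \<equiv> (\<lambda>x. act x e) ` X"

lemma Xe_subset: "x \<in> Xe \<Longrightarrow> x \<in> X"
  using act_closed e_closed by auto

lemma act_e: "x \<in> Xe \<Longrightarrow> act x e = x"
  using e_closed by (auto simp: act_act idem)

lemma carrier_local_monoid: "carrier (local_monoid S e) = (\<lambda>m. e \<otimes> m \<otimes> e) ` carrier S"
  by (simp add: local_monoid_def)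

lemma carrier_local_monoidD:
  assumes "n \<in> carrier (local_monoid S e)"
  shows "n \<in> carrier S" "e \<otimes> n = n" "n \<otimes> e = n"
proof -
  obtain m where m: "m \<in> carrier S" "n = e \<otimes> m \<otimes> e"
    using assms by (auto simp: carrier_local_monoid)
  show "n \<in> carrier S" using m e_closed by simp
  show "e \<otimes> n = n" using m e_closed idem by (simp flip: m_assoc)
  show "n \<otimes> e = n" using m e_closed idem by (simp add: m_assoc)
qed

lemma carrier_local_monoidI:
  assumes "n \<in> carrier S" "e \<otimes> n = n" "n \<otimes> e = n"
  shows "n \<in> carrier (local_monoid S e)"
  unfolding carrier_local_monoid using assms by (intro image_eqI[of _ _ n]) auto

lemma monoid_local_monoid: "monoid (local_monoid S e)"
proof
  have mult: "x \<otimes>\<^bsub>local_monoid S e\<^esub> y = x \<otimes> y" for x y by (simp add: local_monoid_def)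
  have one: "\<one>\<^bsub>local_monoid S e\<^esub> = e" by (simp add: local_monoid_def)
  show "\<one>\<^bsub>local_monoid S e\<^esub> \<in> carrier (local_monoid S e)"
    unfolding one by (rule carrier_local_monoidI) (simp_all add: e_closed idem)
  fix x y z
  assume x: "x \<in> carrier (local_monoid S e)"
  note x' = carrier_local_monoidD[OF x]
  show "\<one>\<^bsub>local_monoid S e\<^esub> \<otimes>\<^bsub>local_monoid S e\<^esub> x = x"
    "x \<otimes>\<^bsub>local_monoid S e\<^esub> \<one>\<^bsub>local_monoid S e\<^esub> = x"
    unfolding one mult using x' by simp_all
  assume y: "y \<in> carrier (local_monoid S e)"
  note y' = carrier_local_monoidD[OF y]
  show "x \<otimes>\<^bsub>local_monoid S e\<^esub> y \<in> carrier (local_monoid S e)"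
    unfolding mult
  proof (rule carrier_local_monoidI)
    show "e \<otimes> (x \<otimes> y) = x \<otimes> y"
      using m_assoc[of e x y] x' y' e_closed by simp
  qed (use x' y' e_closed in \<open>simp_all add: m_assoc\<close>)
  assume z: "z \<in> carrier (local_monoid S e)"
  show "x \<otimes>\<^bsub>local_monoid S e\<^esub> y \<otimes>\<^bsub>local_monoid S e\<^esub> z =
        x \<otimes>\<^bsub>local_monoid S e\<^esub> (y \<otimes>\<^bsub>local_monoid S e\<^esub> z)"
    unfolding mult using x' y' carrier_local_monoidD[OF z] by (simp add: m_assoc)
qed

lemma act_local_closed:
  assumes "x \<in> Xe" "n \<in> carrier (local_monoid S e)"
  shows "act x n \<in> Xe"
proof -
  note n = carrier_local_monoidD[OF assms(2)]
  have "act x n = act (act x n) e"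
    using n e_closed Xe_subset[OF assms(1)] by (simp add: act_act)
  then show ?thesis using act_closed[OF Xe_subset[OF assms(1)] n(1)] by blast
qed

text \<open>For \<open>x\<close> in \<open>Xe\<close> one has \<open>xme = x(eme)\<close>, so stability of \<open>q\<close> under \<open>eSe\<close> puts \<open>q\<close> inside its
  lift; conversely the lift restricts to \<open>q\<close> on \<open>Xe\<close> by taking \<open>m = 1\<close>.\<close>

lemma lifted_congruence_on_Xe:
  assumes "action_congruence (local_monoid S e) Xe act q" "x \<in> Xe" "y \<in> Xe"
  shows "(x, y) \<in> lifted_congruence S e X act q \<longleftrightarrow> (x, y) \<in> q"
proof
  assume "(x, y) \<in> lifted_congruence S e X act q"
  then have "(act (act x \<one>) e, act (act y \<one>) e) \<in> q"
    by (auto simp: lifted_congruence_def)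
  then show "(x, y) \<in> q"
    using assms(2,3) Xe_subset right_actionD(3)[OF right_action] act_e by metis
next
  assume xy: "(x, y) \<in> q"
  have *: "act (act z m) e = act z (e \<otimes> m \<otimes> e)" if "z \<in> Xe" "m \<in> carrier S" for z m
  proof -
    have "act (act z m) e = act (act (act z e) m) e" using act_e[OF that(1)] by simp
    also have "\<dots> = act z (e \<otimes> m \<otimes> e)"
      using that Xe_subset e_closed by (simp add: act_act act_closed)
    finally show ?thesis .
  qed
  have "(act x n, act y n) \<in> q" if "n \<in> carrier (local_monoid S e)" for n
    using assms(1) xy that by (auto simp: action_congruence_def)
  then show "(x, y) \<in> lifted_congruence S e X act q"
    using assms(2,3) Xe_subset by (auto simp: lifted_congruence_def * carrier_local_monoid)
qed

lemma primitive_local_congruence: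
  assumes "primitive_action S X act" and q: "action_congruence (local_monoid S e) Xe act q"
  shows "q = Id_on Xe \<or> q = Xe \<times> Xe"
proof -
  let ?l = "lifted_congruence S e X act q"
  have eq: "equiv Xe q" using q by (simp add: action_congruence_def)
  have "action_congruence S X act ?l"
    by (rule action_congruence_lifted_congruence[OF right_action eq]) simp
  then have "?l = Id_on X \<or> ?l = X \<times> X"
    using assms(1) by (auto simp: primitive_action_def)
  moreover have "q = ?l \<inter> (Xe \<times> Xe)"
    using lifted_congruence_on_Xe[OF q] equiv_type[OF eq] by auto
  moreover have "Id_on X \<inter> Xe \<times> Xe = Id_on Xe" "X \<times> X \<inter> Xe \<times> Xe = Xe \<times> Xe"
    using Xe_subset by auto
  ultimately show ?thesis by metis
qed

lemma action_congruence_eq_prime: "action_congruence S X act (eq_prime S e X act)"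
  unfolding eq_prime_eq_lifted_congruence
  by (rule action_congruence_lifted_congruence[OF right_action, of UNIV])
    (auto simp: equiv_def refl_on_def sym_def trans_def)

text \<open>Distinct points of \<open>Xe\<close> are fixed by \<open>e\<close>, hence separated by \<open>='\<close>; so \<open>='\<close> is not universal,
  and primitivity leaves only equality.\<close>

lemma primitive_eq_prime:
  assumes "primitive_action S X act" and x: "x \<in> Xe" and y: "y \<in> Xe" and "x \<noteq> y"
  shows "eq_prime S e X act = Id_on X"
proof -
  have "(act (act x \<one>) e, act (act y \<one>) e) \<notin> Id"
    using act_e[OF x] act_e[OF y] \<open>x \<noteq> y\<close> Xe_subset[OF x] Xe_subset[OF y]
      right_actionD(3)[OF right_action] by simp
  then have "(x, y) \<notin> eq_prime S e X act"
    unfolding eq_prime_def using one_closed by blast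
  moreover have "(x, y) \<in> X \<times> X"
    using x y Xe_subset by blast
  ultimately show ?thesis
    using assms(1) action_congruence_eq_prime unfolding primitive_action_def by blast
qed


section \<open>The induced action and its evaluation\<close>

abbreviation base_act where "base_act \<equiv> \<lambda>(x, m) m'. (x, m \<otimes> m')"

abbreviation ind_class where "ind_class p \<equiv> ind_rel S e Xe act `` {p}"

text \<open>The defining relations \<open>(xn, m) \<approx> (x, nm)\<close> of the tensor product.\<close>

definition ind_gen where
  "ind_gen = {((act x n, m), (x, n \<otimes> m)) | x n m.
     x \<in> Xe \<and> n \<in> carrier (local_monoid S e) \<and> m \<in> (\<lambda>m. e \<otimes> m) ` carrier S}"

lemma ind_rel_eq: "ind_rel S e Xe act = generated_equiv (ind_base S e Xe) ind_gen"
  by (simp add: ind_rel_def ind_gen_def)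

lemma eS_I: "m \<in> carrier S \<Longrightarrow> e \<otimes> m = m \<Longrightarrow> m \<in> (\<lambda>m. e \<otimes> m) ` carrier S"
  by force

lemma eS_D: "m \<in> (\<lambda>m. e \<otimes> m) ` carrier S \<Longrightarrow> m \<in> carrier S \<and> e \<otimes> m = m"
  using e_closed idem by (auto simp flip: m_assoc)

lemma eS_mult:
  assumes "m \<in> (\<lambda>m. e \<otimes> m) ` carrier S" "m' \<in> carrier S"
  shows "m \<otimes> m' \<in> (\<lambda>m. e \<otimes> m) ` carrier S"
  using assms e_closed by (auto simp: m_assoc)

lemma right_action_base: "right_action S (ind_base S e Xe) base_act"
  unfolding right_action_def
proof (intro conjI ballI monoid_axioms)
  fix p assume "p \<in> ind_base S e Xe"
  then obtain x k where xk: "p = (x, k)" "x \<in> Xe" "k \<in> (\<lambda>m. e \<otimes> m) ` carrier S"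
    unfolding ind_base_def by blast
  have k: "k \<in> carrier S" using eS_D[OF xk(3)] by simp
  show "base_act p \<one> = p" using xk(1) k by simp
  fix m assume m: "m \<in> carrier S"
  show "base_act p m \<in> ind_base S e Xe"
    unfolding xk(1) ind_base_def split using xk(2) eS_mult[OF xk(3) m] by blast
  fix n assume n: "n \<in> carrier S"
  show "base_act (base_act p m) n = base_act p (m \<otimes> n)" using xk(1) k m n by (simp add: m_assoc)
qed

lemma ind_gen_subset: "ind_gen \<subseteq> ind_base S e Xe \<times> ind_base S e Xe"
proof -
  have "n \<otimes> m \<in> (\<lambda>m. e \<otimes> m) ` carrier S"
    if "n \<in> carrier (local_monoid S e)" "m \<in> (\<lambda>m. e \<otimes> m) ` carrier S" for n m
    using carrier_local_monoidD[OF that(1)] eS_D[OF that(2)]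
    by (intro eS_mult eS_I) auto
  then show ?thesis
    using act_local_closed unfolding ind_gen_def ind_base_def by blast
qed

lemma action_congruence_ind_rel:
  "action_congruence S (ind_base S e Xe) base_act (ind_rel S e Xe act)"
  unfolding ind_rel_eq
proof (rule action_congruence_generated_equiv[OF right_action_base ind_gen_subset])
  fix p p' m' assume "(p, p') \<in> ind_gen" and m': "m' \<in> carrier S"
  then obtain x n m where *: "p = (act x n, m)" "p' = (x, n \<otimes> m)" "x \<in> Xe"
    "n \<in> carrier (local_monoid S e)" "m \<in> (\<lambda>m. e \<otimes> m) ` carrier S"
    unfolding ind_gen_def by blast
  have "n \<otimes> m \<otimes> m' = n \<otimes> (m \<otimes> m')"
    using carrier_local_monoidD(1)[OF *(4)] eS_D[OF *(5)] m' by (simp add: m_assoc)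
  then show "(base_act p m', base_act p' m') \<in> ind_gen"
    unfolding ind_gen_def using * eS_mult[OF *(5) m'] by auto
qed

lemma right_action_ind: "right_action S (ind S e Xe act) (ind_act S e Xe act)"
  unfolding ind_def ind_act_def
  by (rule right_action_quotient[OF right_action_base action_congruence_ind_rel])

lemma equiv_ind_rel: "equiv (ind_base S e Xe) (ind_rel S e Xe act)"
  using action_congruence_ind_rel by (simp add: action_congruence_def)

lemma ind_act_class:
  assumes "(x, n) \<in> ind_base S e Xe" "m \<in> carrier S"
  shows "ind_act S e Xe act (ind_class (x, n)) m = ind_class (x, n \<otimes> m)"
  unfolding ind_act_def
  using quotient_act_class[OF right_action_base action_congruence_ind_rel assms] by simp

lemma indE:
  assumes "C \<in> ind S e Xe act"
  obtains x n where "(x, n) \<in> ind_base S e Xe" "C = ind_class (x, n)"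
    "x \<in> X" "n \<in> carrier S" "e \<otimes> n = n"
proof -
  obtain x n where C: "(x, n) \<in> ind_base S e Xe" "C = ind_class (x, n)"
    using assms unfolding ind_def by (auto elim!: quotientE)
  then have "x \<in> Xe" "n \<in> (\<lambda>m. e \<otimes> m) ` carrier S" unfolding ind_base_def by blast+
  then show thesis using that[OF C] Xe_subset eS_D by blast
qed

text \<open>All representatives \<open>(x, n)\<close> of an element of the induced action have the same \<open>xn\<close>, so the
  image below is a singleton.\<close>

definition ind_eval :: "('x \<times> 'm) set \<Rightarrow> 'x" where
  "ind_eval C = the_elem ((\<lambda>(x, n). act x n) ` C)"

lemma ind_eval_class:
  assumes "(x, n) \<in> ind_base S e Xe"
  shows "ind_eval (ind_class (x, n)) = act x n"
proof -
  have *: "(\<lambda>(x, n). act x n) a = (\<lambda>(x, n). act x n) b" if "(a, b) \<in> ind_gen" for a b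
  proof -
    obtain x n m where ab: "a = (act x n, m)" "b = (x, n \<otimes> m)" and x: "x \<in> Xe"
      and n: "n \<in> carrier (local_monoid S e)" and m: "m \<in> (\<lambda>m. e \<otimes> m) ` carrier S"
      using \<open>(a, b) \<in> ind_gen\<close> unfolding ind_gen_def by blast
    show ?thesis
      using Xe_subset[OF x] carrier_local_monoidD(1)[OF n] eS_D[OF m]
      by (simp add: ab act_act)
  qed
  have "(\<lambda>(x, n). act x n) p = act x n" if "p \<in> ind_class (x, n)" for p
  proof -
    have "((x, n), p) \<in> generated_equiv (ind_base S e Xe) ind_gen"
      using that unfolding ind_rel_eq by simp
    from generated_equiv_respects[where f = "\<lambda>(x, n). act x n", OF this ind_gen_subset *]
    show ?thesis by auto
  qed
  moreover have "(x, n) \<in> ind_class (x, n)" using equiv_class_self[OF equiv_ind_rel assms] .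
  ultimately have "(\<lambda>(x, n). act x n) ` ind_class (x, n) = {act x n}" by blast
  then show ?thesis by (simp add: ind_eval_def)
qed

lemma ind_eval_closed: "C \<in> ind S e Xe act \<Longrightarrow> ind_eval C \<in> X"
  by (metis indE ind_eval_class act_closed)

lemma ind_eval_act:
  assumes "C \<in> ind S e Xe act" "m \<in> carrier S"
  shows "ind_eval (ind_act S e Xe act C m) = act (ind_eval C) m"
proof -
  obtain x n where C: "(x, n) \<in> ind_base S e Xe" "C = ind_class (x, n)"
    "x \<in> X" "n \<in> carrier S" "e \<otimes> n = n" using assms(1) by (rule indE)
  have "(x, n \<otimes> m) \<in> ind_base S e Xe"
    using right_actionD(2)[OF right_action_base C(1) assms(2)] by simp
  then show ?thesis
    using C assms(2) by (simp add: ind_act_class ind_eval_class act_act)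
qed

lemma ind_eval_surj:
  assumes transitive: "\<And>x. x \<in> X \<Longrightarrow> act x ` carrier S = X"
  shows "ind_eval ` ind S e Xe act = X"
proof
  show "ind_eval ` ind S e Xe act \<subseteq> X" using ind_eval_closed by blast
  show "X \<subseteq> ind_eval ` ind S e Xe act"
  proof
    fix y assume y: "y \<in> X"
    let ?x = "act y e"
    have "?x \<in> X" using act_closed[OF y e_closed] .
    then obtain m where m: "m \<in> carrier S" "y = act ?x m" using transitive y by blast
    have b: "(?x, e \<otimes> m) \<in> ind_base S e Xe" using m(1) y unfolding ind_base_def by blast
    have "act ?x (e \<otimes> m) = y"
      using m act_act[OF \<open>?x \<in> X\<close> e_closed m(1)] act_e[of ?x] y by auto
    then have "ind_eval (ind_class (?x, e \<otimes> m)) = y" using ind_eval_class[OF b] by simp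
    moreover have "ind_class (?x, e \<otimes> m) \<in> ind S e Xe act"
      unfolding ind_def by (rule quotientI[OF b])
    ultimately show "y \<in> ind_eval ` ind S e Xe act" by (metis image_eqI)
  qed
qed

text \<open>The key formula \<open>(x \<otimes> n)me = x \<otimes> nme = xnme \<otimes> e\<close>: as \<open>n\<close> lies in \<open>eS\<close>, the element \<open>nme\<close>
  lies in \<open>eSe\<close> and moves across the tensor sign.\<close>

lemma ind_act_me:
  assumes "C \<in> ind S e Xe act" and m: "m \<in> carrier S"
  shows "ind_act S e Xe act (ind_act S e Xe act C m) e =
         ind_class (act (act (ind_eval C) m) e, e)"
proof -
  obtain x n where C: "(x, n) \<in> ind_base S e Xe" "C = ind_class (x, n)"
    "x \<in> X" "n \<in> carrier S" "e \<otimes> n = n" using assms(1) by (rule indE)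
  let ?k = "n \<otimes> m \<otimes> e"
  have nm: "(x, n \<otimes> m) \<in> ind_base S e Xe"
    using right_actionD(2)[OF right_action_base C(1) m] by simp
  have "?k = e \<otimes> (n \<otimes> m) \<otimes> e"
    using C(4,5) m e_closed by (simp flip: m_assoc)
  then have k: "?k \<in> carrier (local_monoid S e)"
    using C(4) m unfolding carrier_local_monoid by blast
  have "x \<in> Xe" using C(1) unfolding ind_base_def by blast
  then have "((act x ?k, e), (x, ?k \<otimes> e)) \<in> ind_gen"
    unfolding ind_gen_def using k eS_I[OF e_closed idem] by blast
  moreover have "?k \<otimes> e = ?k" using carrier_local_monoidD(3)[OF k] .
  ultimately have "((act x ?k, e), (x, ?k)) \<in> ind_rel S e Xe act"
    unfolding ind_rel_eq using subset_generated_equiv[OF ind_gen_subset] by auto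
  then have "ind_class (act x ?k, e) = ind_class (x, ?k)"
    by (rule equiv_class_eq[OF equiv_ind_rel])
  moreover have "act x ?k = act (act (ind_eval C) m) e"
    using C m e_closed by (simp add: ind_eval_class act_act)
  ultimately show ?thesis
    using C m nm e_closed by (simp add: ind_act_class)
qed

lemma eq_prime_ind_iff:
  assumes C: "C \<in> ind S e Xe act" and D: "D \<in> ind S e Xe act"
  shows "(C, D) \<in> eq_prime S e (ind S e Xe act) (ind_act S e Xe act) \<longleftrightarrow>
         (ind_eval C, ind_eval D) \<in> eq_prime S e X act"
proof
  note closed = right_actionD(2)[OF right_action_ind]
  assume "(C, D) \<in> eq_prime S e (ind S e Xe act) (ind_act S e Xe act)"
  then have "ind_eval (ind_act S e Xe act (ind_act S e Xe act C m) e) =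
      ind_eval (ind_act S e Xe act (ind_act S e Xe act D m) e)" if "m \<in> carrier S" for m
    using that by (simp add: eq_prime_def)
  then show "(ind_eval C, ind_eval D) \<in> eq_prime S e X act"
    using C D by (simp add: eq_prime_def ind_eval_act closed e_closed ind_eval_closed)
next
  assume "(ind_eval C, ind_eval D) \<in> eq_prime S e X act"
  then show "(C, D) \<in> eq_prime S e (ind S e Xe act) (ind_act S e Xe act)"
    using C D by (simp add: eq_prime_def ind_act_me)
qed

theorem isomorphic_ind_quotient:
  assumes prim: "primitive_action S X act"
    and transitive: "\<And>x. x \<in> X \<Longrightarrow> act x ` carrier S = X"
    and "x \<in> Xe" "y \<in> Xe" "x \<noteq> y"
  defines "I \<equiv> ind S e Xe act" and "iact \<equiv> ind_act S e Xe act"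
  shows "action_congruence S I iact (eq_prime S e I iact)"
    and "isomorphic_actions S X act (I // eq_prime S e I iact)
           (quotient_act (eq_prime S e I iact) iact)"
proof -
  interpret I: idempotent_action S I iact e
    unfolding I_def iact_def
    by unfold_locales (rule right_action_ind e_closed idem)+
  show c: "action_congruence S I iact (eq_prime S e I iact)"
    by (rule I.action_congruence_eq_prime)
  show "isomorphic_actions S X act (I // eq_prime S e I iact)
          (quotient_act (eq_prime S e I iact) iact)"
  proof (rule isomorphic_actions_quotient_kernel[OF I.right_action right_action c])
    show "ind_eval ` I = X" unfolding I_def by (rule ind_eval_surj[OF transitive])
    show "ind_eval (iact C m) = act (ind_eval C) m" if "C \<in> I" "m \<in> carrier S" for C m
      using that unfolding I_def iact_def by (rule ind_eval_act)
    show "(C, D) \<in> eq_prime S e I iact \<longleftrightarrow> ind_eval C = ind_eval D"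
      if "C \<in> I" "D \<in> I" for C D
      using eq_prime_ind_iff[OF that[unfolded I_def]] ind_eval_closed[OF that(1)[unfolded I_def]]
      unfolding I_def iact_def primitive_eq_prime[OF prim assms(3-5)] by (simp only: Id_on_iff) simp
  qed
qed

end


section \<open>Local monoids in the minimal ideal of a finite monoid\<close>

text \<open>In a finite monoid one-sided inverses are two-sided: if \<open>ab = 1\<close>, left multiplication by \<open>b\<close>
  is injective, hence surjective.\<close>

lemma (in monoid) finite_left_inverse_imp_right_inverse:
  assumes fin: "finite (carrier G)" and a: "a \<in> carrier G" and b: "b \<in> carrier G"
    and ab: "a \<otimes> b = \<one>"
  shows "b \<otimes> a = \<one>"
proof -
  have cancel: "a \<otimes> (b \<otimes> x) = x" if "x \<in> carrier G" for x
    using that a b ab by (simp flip: m_assoc)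
  have "inj_on (\<lambda>x. b \<otimes> x) (carrier G)"
    by (rule inj_on_inverseI[of _ "\<lambda>x. a \<otimes> x"]) (rule cancel)
  then have "(\<lambda>x. b \<otimes> x) ` carrier G = carrier G"
    using b by (intro endo_inj_surj[OF fin]) auto
  then obtain x where x: "x \<in> carrier G" "b \<otimes> x = \<one>" using one_closed by (metis imageE)
  then have "x = a" using cancel[of x] a by simp
  then show ?thesis using x by simp
qed

text \<open>An element \<open>n\<close> of \<open>eSe\<close> generates the minimal ideal, so \<open>e = xny = (exe)n(eye)\<close>; in the finite
  monoid \<open>eSe\<close> this makes \<open>n\<close> invertible.\<close>

lemma Units_local_monoid:
  assumes S: "monoid S" and fin: "finite (carrier S)" and e: "e \<in> idempotents S (min_ideal S)"
  shows "Units (local_monoid S e) = carrier (local_monoid S e)"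
proof
  show "Units (local_monoid S e) \<subseteq> carrier (local_monoid S e)" by (auto simp: Units_def)
  interpret monoid S by fact
  have min: "minimal_ideal S (min_ideal S)"
    unfolding min_ideal_def by (rule theI'[OF minimal_ideal_ex1[OF S fin]])
  then have I: "two_sided_ideal S (min_ideal S)" by (simp add: minimal_ideal_def)
  have e': "e \<in> min_ideal S" "e \<otimes>\<^bsub>S\<^esub> e = e" using e by (auto simp: idempotents_def)
  then have eS: "e \<in> carrier S" using I by (auto simp: two_sided_ideal_def)
  interpret idempotent_action S "carrier S" "\<lambda>x m. x \<otimes>\<^bsub>S\<^esub> m" e
    using e' eS by unfold_locales (auto simp: right_action_def S m_assoc)
  let ?L = "local_monoid S e"
  interpret L: monoid ?L by (rule monoid_local_monoid)
  have mult: "x \<otimes>\<^bsub>?L\<^esub> y = x \<otimes>\<^bsub>S\<^esub> y" for x y by (simp add: local_monoid_def)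
  have one: "\<one>\<^bsub>?L\<^esub> = e" by (simp add: local_monoid_def)
  have finL: "finite (carrier ?L)" using fin by (simp add: carrier_local_monoid)
  show "carrier ?L \<subseteq> Units ?L"
  proof
    fix n assume n: "n \<in> carrier ?L"
    note n' = carrier_local_monoidD[OF n]
    let ?J = "{x \<otimes>\<^bsub>S\<^esub> n \<otimes>\<^bsub>S\<^esub> y | x y. x \<in> carrier S \<and> y \<in> carrier S}"
    have "n \<in> min_ideal S"
      using I e'(1) n'(1,2) unfolding two_sided_ideal_def by metis
    then have "?J \<subseteq> min_ideal S"
      using I by (auto simp: two_sided_ideal_def)
    moreover have "two_sided_ideal S ?J"
      unfolding two_sided_ideal_def
    proof (intro conjI ballI)
      show "?J \<noteq> {}" using one_closed by blast
      show "?J \<subseteq> carrier S" using n'(1) by auto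
      fix z m assume "z \<in> ?J" and m: "m \<in> carrier S"
      then obtain x y where xy: "z = x \<otimes>\<^bsub>S\<^esub> n \<otimes>\<^bsub>S\<^esub> y" "x \<in> carrier S" "y \<in> carrier S" by blast
      have "z \<otimes>\<^bsub>S\<^esub> m = x \<otimes>\<^bsub>S\<^esub> n \<otimes>\<^bsub>S\<^esub> (y \<otimes>\<^bsub>S\<^esub> m)"
        "m \<otimes>\<^bsub>S\<^esub> z = (m \<otimes>\<^bsub>S\<^esub> x) \<otimes>\<^bsub>S\<^esub> n \<otimes>\<^bsub>S\<^esub> y"
        using xy m n'(1) by (simp_all add: m_assoc)
      then show "z \<otimes>\<^bsub>S\<^esub> m \<in> ?J" "m \<otimes>\<^bsub>S\<^esub> z \<in> ?J"
        using xy m m_closed by blast+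
    qed
    ultimately have "?J = min_ideal S" using min unfolding minimal_ideal_def by blast
    then have "e \<in> ?J" using e'(1) by simp
    then obtain x y where xy: "e = x \<otimes>\<^bsub>S\<^esub> n \<otimes>\<^bsub>S\<^esub> y" "x \<in> carrier S" "y \<in> carrier S"
      by blast
    let ?a = "e \<otimes>\<^bsub>S\<^esub> x \<otimes>\<^bsub>S\<^esub> e" and ?b = "e \<otimes>\<^bsub>S\<^esub> y \<otimes>\<^bsub>S\<^esub> e"
    have ab: "?a \<in> carrier ?L" "?b \<in> carrier ?L" using xy(2,3) unfolding carrier_local_monoid by blast+
    have "?a \<otimes>\<^bsub>S\<^esub> n \<otimes>\<^bsub>S\<^esub> ?b = e \<otimes>\<^bsub>S\<^esub> (x \<otimes>\<^bsub>S\<^esub> (e \<otimes>\<^bsub>S\<^esub> n \<otimes>\<^bsub>S\<^esub> e) \<otimes>\<^bsub>S\<^esub> y) \<otimes>\<^bsub>S\<^esub> e"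
      using xy(2,3) n'(1) eS by (simp add: m_assoc)
    also have "\<dots> = e" using n' e'(2) xy(1)[symmetric] by simp
    finally have 1: "?a \<otimes>\<^bsub>?L\<^esub> n \<otimes>\<^bsub>?L\<^esub> ?b = \<one>\<^bsub>?L\<^esub>" by (simp only: mult one)
    have "n \<otimes>\<^bsub>?L\<^esub> ?b \<otimes>\<^bsub>?L\<^esub> ?a = \<one>\<^bsub>?L\<^esub>" "?b \<otimes>\<^bsub>?L\<^esub> (?a \<otimes>\<^bsub>?L\<^esub> n) = \<one>\<^bsub>?L\<^esub>"
      by (rule L.finite_left_inverse_imp_right_inverse[OF finL];
          simp only: L.m_closed L.m_assoc[symmetric] n ab 1)+
    then have "n \<otimes>\<^bsub>?L\<^esub> (?b \<otimes>\<^bsub>?L\<^esub> ?a) = \<one>\<^bsub>?L\<^esub>" "(?b \<otimes>\<^bsub>?L\<^esub> ?a) \<otimes>\<^bsub>?L\<^esub> n = \<one>\<^bsub>?L\<^esub>"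
      by (simp_all only: L.m_assoc n ab)
    then show "n \<in> Units ?L"
      unfolding Units_def using n L.m_closed[OF ab(2,1)] by blast
  qed
qed


section \<open>Transformation monoids\<close>

lemma tmonoid_simps:
  "carrier (tmonoid \<Omega> M) = M"
  "f \<otimes>\<^bsub>tmonoid \<Omega> M\<^esub> g = compose \<Omega> g f"
  "\<one>\<^bsub>tmonoid \<Omega> M\<^esub> = (\<lambda>x\<in>\<Omega>. x)"
  by (simp_all add: tmonoid_def full_transformation_monoid_def)

lemma transformation_monoid_alt:
  "transformation_monoid \<Omega> M \<longleftrightarrow> \<Omega> \<noteq> {} \<and> M \<subseteq> \<Omega> \<rightarrow>\<^sub>E \<Omega> \<and> (\<lambda>x\<in>\<Omega>. x) \<in> M \<and>
     (\<forall>f\<in>M. \<forall>g\<in>M. compose \<Omega> g f \<in> M)"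
  by (auto simp: transformation_monoid_def submonoid_def full_transformation_monoid_def)

lemma right_action_tmonoid:
  assumes "transformation_monoid \<Omega> M"
  shows "right_action (tmonoid \<Omega> M) \<Omega> app"
proof -
  have M: "M \<subseteq> \<Omega> \<rightarrow>\<^sub>E \<Omega>" "(\<lambda>x\<in>\<Omega>. x) \<in> M" "\<And>f g. f \<in> M \<Longrightarrow> g \<in> M \<Longrightarrow> compose \<Omega> g f \<in> M"
    using assms by (auto simp: transformation_monoid_alt)
  have 1: "f x \<in> \<Omega>" if "f \<in> M" "x \<in> \<Omega>" for f x
    using M(1) that by (meson PiE_mem subsetD)
  have 2: "f \<in> extensional \<Omega>" if "f \<in> M" for f using M(1) that unfolding PiE_def by blast
  have "monoid (tmonoid \<Omega> M)"
  proof (rule monoidI; unfold tmonoid_simps)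
    show "(\<lambda>x\<in>\<Omega>. x) \<in> M" by (rule M(2))
    fix f g h assume f: "f \<in> M"
    show "compose \<Omega> f (\<lambda>x\<in>\<Omega>. x) = f" "compose \<Omega> (\<lambda>x\<in>\<Omega>. x) f = f"
      using 1[OF f] 2[OF f] by (auto intro!: compose_Id Id_compose)
    assume g: "g \<in> M"
    show "compose \<Omega> g f \<in> M" by (rule M(3)[OF f g])
    show "compose \<Omega> h (compose \<Omega> g f) = compose \<Omega> (compose \<Omega> h g) f"
      by (rule compose_assoc) (use 1[OF f] in auto)
  qed
  then show ?thesis
    using 1 by (simp add: right_action_def tmonoid_simps app_def compose_eq)
qed

theorem corollary5p3:
  fixes \<Omega> :: "'a set" and M :: "('a \<Rightarrow> 'a) set" and e :: "'a \<Rightarrow> 'a"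
  defines "S \<equiv> tmonoid \<Omega> M"
  defines "\<Omega>e \<equiv> (\<lambda>\<alpha>. app \<alpha> e) ` \<Omega>"
  defines "G \<equiv> maximal_subgroup S e"
  defines "\<rho> \<equiv> (\<lambda>g. restrict g \<Omega>e)"
  defines "IndS \<equiv> ind S e \<Omega>e app"
  defines "act \<equiv> ind_act S e \<Omega>e app"
  defines "r \<equiv> eq_prime S e IndS act"
  assumes "transformation_monoid \<Omega> M" and "finite \<Omega>"
    and "transitive_tm \<Omega> M" and "primitive_tm \<Omega> M"
    and "card \<Omega> \<ge> 3"
    and "e \<in> idempotents S (min_ideal S)"
  shows "(inj_on \<rho> (carrier G) \<and>
          permutation_group \<Omega>e (\<rho> ` carrier G) \<and>
          primitive_tm \<Omega>e (\<rho> ` carrier G)) \<and>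
         (carrier G \<noteq> {\<one>\<^bsub>G\<^esub>} \<longrightarrow>
            action_congruence S IndS act r \<and>
            isomorphic_actions S \<Omega> app (IndS // r) (quotient_act r act))"
proof -
  have M: "\<Omega> \<noteq> {}" "M \<subseteq> \<Omega> \<rightarrow>\<^sub>E \<Omega>"
    using \<open>transformation_monoid \<Omega> M\<close> by (auto simp: transformation_monoid_alt)
  have ra: "right_action S \<Omega> app"
    unfolding S_def by (rule right_action_tmonoid) fact
  have prim: "primitive_action S \<Omega> app"
    using \<open>primitive_tm \<Omega> M\<close> by (simp add: primitive_tm_def S_def)
  interpret S: monoid S by (rule right_actionD(1)[OF ra])
  have finS: "finite (carrier S)"
    using finite_subset[OF M(2) finite_PiE] \<open>finite \<Omega>\<close> by (simp add: S_def tmonoid_simps)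
  have U: "Units (local_monoid S e) = carrier (local_monoid S e)"
    by (rule Units_local_monoid) (fact S.monoid_axioms finS assms(13))+
  have min: "minimal_ideal S (min_ideal S)"
    unfolding min_ideal_def by (rule theI'[OF minimal_ideal_ex1[OF S.monoid_axioms finS]])
  have eS: "e \<in> carrier S" and idem: "e \<otimes>\<^bsub>S\<^esub> e = e"
    using assms(13) min by (auto simp: idempotents_def minimal_ideal_def two_sided_ideal_def)
  interpret A: idempotent_action S \<Omega> app e
    by unfold_locales (fact ra eS idem)+
  interpret L: monoid "local_monoid S e" by (rule A.monoid_local_monoid)
  have Gc: "carrier G = carrier (local_monoid S e)"
    by (simp add: G_def maximal_subgroup_def units_of_carrier U)
  have G1: "\<one>\<^bsub>G\<^esub> = e"
    by (simp add: G_def maximal_subgroup_def units_of_def local_monoid_def)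
  have mult: "f \<otimes>\<^bsub>local_monoid S e\<^esub> g = compose \<Omega> g f" for f g
    by (simp add: local_monoid_def S_def tmonoid_simps)
  have e_in: "e \<in> carrier G" using L.one_closed unfolding Gc by (simp add: local_monoid_def)
  have closed: "compose \<Omega> g f \<in> carrier G" if "f \<in> carrier G" "g \<in> carrier G" for f g
    using L.m_closed that unfolding Gc mult by blast
  have inverse: "\<exists>h\<in>carrier G. compose \<Omega> h g = e \<and> compose \<Omega> g h = e" if "g \<in> carrier G" for g
    using that U unfolding Gc Units_def mult by (auto simp: local_monoid_def)
  have sub: "\<Omega>e \<subseteq> \<Omega>" using A.Xe_subset by (auto simp: \<Omega>e_def)
  have ne: "\<Omega>e \<noteq> {}" using M(1) by (simp add: \<Omega>e_def)
  have maps: "g x \<in> \<Omega>e" if "g \<in> carrier G" "x \<in> \<Omega>e" for g x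
    using A.act_local_closed that unfolding Gc \<Omega>e_def app_def by blast
  have e_id: "e x = x" if "x \<in> \<Omega>e" for x
    using A.act_e that unfolding \<Omega>e_def app_def by blast
  have \<rho>e: "\<rho> e = (\<lambda>x\<in>\<Omega>e. x)" by (auto simp: \<rho>_def e_id)
  have \<rho>_mult: "compose \<Omega>e (\<rho> g) (\<rho> f) = \<rho> (compose \<Omega> g f)" if "f \<in> carrier G" for f g
    using maps[OF that] sub by (auto simp: \<rho>_def compose_def fun_eq_iff)

  \<comment> \<open>Faithfulness: \<open>g = eg\<close> is determined by its values on \<open>\<Omega>e\<close>.\<close>
  have inj: "inj_on \<rho> (carrier G)"
  proof (rule inj_onI)
    fix g h assume g: "g \<in> carrier G" and h: "h \<in> carrier G" and eq: "\<rho> g = \<rho> h"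
    have "compose \<Omega> g e = g" "compose \<Omega> h e = h"
      using A.carrier_local_monoidD(2) g h unfolding Gc by (auto simp: S_def tmonoid_simps)
    moreover have "g (e x) = h (e x)" if "x \<in> \<Omega>" for x
      using fun_cong[OF eq, of "e x"] that by (simp add: \<rho>_def \<Omega>e_def app_def)
    then have "compose \<Omega> g e = compose \<Omega> h e" by (auto simp: compose_def)
    ultimately show "g = h" by metis
  qed

  have bij: "\<rho> g \<in> Bij \<Omega>e" if g: "g \<in> carrier G" for g
  proof -
    obtain h where h: "h \<in> carrier G" "compose \<Omega> h g = e" "compose \<Omega> g h = e"
      using inverse[OF g] by blast
    have "h (g x) = x" "g (h x) = x" if "x \<in> \<Omega>e" for x
      using fun_cong[OF h(2), of x] fun_cong[OF h(3), of x] that sub e_id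
      by (auto simp: compose_def split: if_splits)
    then have "bij_betw g \<Omega>e \<Omega>e"
      using maps[OF g] maps[OF h(1)] by (intro bij_betw_byWitness[of _ h]) auto
    then show ?thesis by (simp add: Bij_def \<rho>_def)
  qed

  interpret B: group "BijGroup \<Omega>e" by (rule group_BijGroup)
  have B_mult: "\<rho> g \<otimes>\<^bsub>BijGroup \<Omega>e\<^esub> \<rho> f = \<rho> (compose \<Omega> g f)"
    if "f \<in> carrier G" "g \<in> carrier G" for f g
    using bij that by (simp add: BijGroup_def \<rho>_mult)
  have B_one: "\<one>\<^bsub>BijGroup \<Omega>e\<^esub> = \<rho> e" by (simp add: BijGroup_def \<rho>e)
  have "subgroup (\<rho> ` carrier G) (BijGroup \<Omega>e)"
  proof (rule B.subgroupI)
    show "\<rho> ` carrier G \<subseteq> carrier (BijGroup \<Omega>e)" using bij by (auto simp: BijGroup_def)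
    show "\<rho> ` carrier G \<noteq> {}" using e_in by blast
    fix a assume "a \<in> \<rho> ` carrier G"
    then obtain g where g: "g \<in> carrier G" "a = \<rho> g" by blast
    obtain h where h: "h \<in> carrier G" "compose \<Omega> h g = e" using inverse[OF g(1)] by blast
    have "inv\<^bsub>BijGroup \<Omega>e\<^esub> a = \<rho> h"
      using B_mult[OF g(1) h(1)] h bij[OF g(1)] bij[OF h(1)] g(2)
      by (intro B.inv_equality) (auto simp: B_one, auto simp: BijGroup_def)
    then show "inv\<^bsub>BijGroup \<Omega>e\<^esub> a \<in> \<rho> ` carrier G" using h(1) by simp
    fix b assume "b \<in> \<rho> ` carrier G"
    then show "a \<otimes>\<^bsub>BijGroup \<Omega>e\<^esub> b \<in> \<rho> ` carrier G" using B_mult g closed by auto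
  qed
  then have perm: "permutation_group \<Omega>e (\<rho> ` carrier G)"
    using ne by (simp add: permutation_group_def)

  have "transformation_monoid \<Omega>e (\<rho> ` carrier G)"
    unfolding transformation_monoid_alt
    using ne \<rho>_mult closed maps \<rho>e[symmetric] e_in by (auto simp: \<rho>_def)
  then have "right_action (tmonoid \<Omega>e (\<rho> ` carrier G)) \<Omega>e app"
    by (rule right_action_tmonoid)
  moreover have "q = Id_on \<Omega>e \<or> q = \<Omega>e \<times> \<Omega>e"
    if q: "action_congruence (tmonoid \<Omega>e (\<rho> ` carrier G)) \<Omega>e app q" for q
  proof -
    have eq: "equiv \<Omega>e q" using q by (simp add: action_congruence_def)
    have "(app x g, app y g) \<in> q" if "(x, y) \<in> q" "g \<in> carrier G" for x y g
    proof -
      have "(app x (\<rho> g), app y (\<rho> g)) \<in> q"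
        using q that by (auto simp: action_congruence_def tmonoid_simps)
      moreover have "x \<in> \<Omega>e" "y \<in> \<Omega>e" using equiv_type[OF eq] that(1) by auto
      ultimately show ?thesis by (simp add: app_def \<rho>_def)
    qed
    then have "action_congruence (local_monoid S e) \<Omega>e app q"
      using eq by (auto simp: action_congruence_def Gc)
    then show ?thesis
      using A.primitive_local_congruence[OF prim] unfolding \<Omega>e_def by blast
  qed
  ultimately have "primitive_tm \<Omega>e (\<rho> ` carrier G)"
    by (auto simp: primitive_tm_def primitive_action_def)

  moreover have "action_congruence S IndS act r \<and>
            isomorphic_actions S \<Omega> app (IndS // r) (quotient_act r act)"
    if nontrivial: "carrier G \<noteq> {\<one>\<^bsub>G\<^esub>}"
  proof -
    \<comment> \<open>By faithfulness a non-identity element of \<open>G\<^sub>e\<close> moves some point, so \<open>\<Omega>e\<close> has two points.\<close>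
    obtain g where g: "g \<in> carrier G" "g \<noteq> e" using nontrivial e_in unfolding G1 by blast
    then have "\<rho> g \<noteq> \<rho> e" using inj_onD[OF inj _ g(1) e_in] by blast
    then obtain x where "x \<in> \<Omega>e" "g x \<noteq> e x" unfolding \<rho>_def by (meson restrict_ext)
    then have x: "x \<in> \<Omega>e" "g x \<in> \<Omega>e" "g x \<noteq> x" using maps[OF g(1)] e_id by auto
    have "app \<alpha> ` carrier S = \<Omega>" if "\<alpha> \<in> \<Omega>" for \<alpha>
      using \<open>transitive_tm \<Omega> M\<close> that by (simp add: transitive_tm_def S_def tmonoid_simps)
    from A.isomorphic_ind_quotient[OF prim this x(2)[unfolded \<Omega>e_def] x(1)[unfolded \<Omega>e_def] x(3)]
    show ?thesis unfolding r_def IndS_def act_def \<Omega>e_def by blast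
  qed
  ultimately show ?thesis using inj perm by blast
qed

end
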